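(* Let $\kappa,c\in\mathbb{C}$ be such that $c\neq 0$ and $$\operatorname{Re}\kappa>\max\{0,\ |c|-3/4\}.$$ Let $u_p$ be the generalized and "normalized" Bessel function with parameters $\kappa$ and $c$, i.e. $u_p(z)=\sum_{n\ge 0}\frac{(-c/4)^n}{(\kappa)_n}\frac{z^n}{n!}$. Then $$-\frac{4\kappa}{c}\,u_p'(z)\prec\sqrt{1+z}\quad\text{in } \mathbb{D}.$$
   Context: $\mathbb{D}=\{z\in\mathbb{C}:|z|<1\}$. For analytic functions $f,g$ on $\mathbb{D}$, $f\prec g$ ($f$ is subordinate to $g$) means that there is an analytic $w:\mathbb{D}\to\mathbb{D}$ with $w(0)=0$ and $f=g\circ w$. $\sqrt{1+z}$ denotes the principal branch (value $1$ at $z=0$). $(\lambda)_n=\lambda(\lambda+1)\cdots(\lambda+n-1)$, $(\lambda)_0=1$, is the Pochhammer symbol. For $p,b,c\in\mathbb{C}$ put $\kappa=p+(b+1)/2$, assumed $\neq 0,-1,-2,\ldots$ The generalized and "normalized" Bessel function of the first kind of order $p$ is the entire function $$u_p(z)=u_{p,b,c}(z)=\sum_{n\ge 0}\frac{(-c/4)^n}{(\kappa)_n}\frac{z^n}{n!};$$ it depends only on $\kappa$ and $c$. *)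

theory Defs
  imports "HOL-Complex_Analysis.Complex_Analysis"
begin

abbreviation unit_disc :: "complex set" where
  "unit_disc \<equiv> ball 0 1"

definition subordinate :: "(complex \<Rightarrow> complex) \<Rightarrow> (complex \<Rightarrow> complex) \<Rightarrow> bool"
    (infix "\<prec>\<^sub>s" 50) where
  "f \<prec>\<^sub>s g \<longleftrightarrow>
     f analytic_on unit_disc \<and> g analytic_on unit_disc \<and>
     (\<exists>w. w analytic_on unit_disc \<and> w ` unit_disc \<subseteq> unit_disc \<and> w 0 = 0 \<and>
          (\<forall>z\<in>unit_disc. f z = g (w z)))"

(* The function u_{p,b,c} depends on p and b only through \<kappa> = p + (b + 1) / 2, so it is
   parametrised by \<kappa> and c; every \<kappa> arises (take p = \<kappa>, b = -1).  The definition is meaningful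
   for \<kappa> not in {0, -1, -2, ...}; otherwise pochhammer \<kappa> n vanishes for large n. *)
definition gen_bessel :: "complex \<Rightarrow> complex \<Rightarrow> complex \<Rightarrow> complex" where
  "gen_bessel \<kappa> c z = (\<Sum>n. (- c / 4) ^ n / pochhammer \<kappa> n * (z ^ n / fact n))"

end

theory Submission
  imports Defs
begin

text \<open>
  Differentiation shifts the parameter: $-(4\kappa/c)\,u_\kappa' = u_{\kappa+1}$. Comparing power
  series, $|u_{\kappa+1}(z) - 1| \le e^t - 1$ with $t = |cz| / (4\,\mathrm{Re}(\kappa+1)) < 1/4$ in the
  disc, whence $|u_{\kappa+1}(z)^2 - 1| \le e^{2t} - 1 < 1$ and $\mathrm{Re}\,u_{\kappa+1}(z) > 0$.
  So the Schwarz function is simply $w = u_{\kappa+1}^2 - 1$.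
\<close>

text \<open>Each factor \<open>\<kappa> + k\<close> has norm at least its real part, which is at
  least \<open>Re \<kappa>\<close>.\<close>

lemma norm_pochhammer_ge:
  fixes \<kappa> :: complex
  assumes "Re \<kappa> > 0"
  shows "Re \<kappa> ^ n \<le> norm (pochhammer \<kappa> n)"
proof (induction n)
  case (Suc n)
  have "Re \<kappa> \<le> norm (\<kappa> + of_nat n)"
    using complex_Re_le_cmod[of "\<kappa> + of_nat n"] by simp
  then have "Re \<kappa> ^ n * Re \<kappa> \<le> norm (pochhammer \<kappa> n) * norm (\<kappa> + of_nat n)"
    using Suc assms by (intro mult_mono) auto
  then show ?case
    by (simp add: pochhammer_Suc norm_mult mult.commute)
qed simp

text \<open>The exponential series is the majorant used twice below: for convergence and for the
  distance of the sum from 1.\<close>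

lemma norm_gen_bessel_term_le:
  assumes "Re \<kappa> > 0"
  shows "norm ((- c / 4) ^ n / pochhammer \<kappa> n * (z ^ n / fact n))
           \<le> (norm c * norm z / (4 * Re \<kappa>)) ^ n / fact n"
proof -
  have "norm ((- c / 4) ^ n / pochhammer \<kappa> n * (z ^ n / fact n))
      = (norm c * norm z / 4) ^ n / fact n / norm (pochhammer \<kappa> n)"
    by (simp add: norm_mult norm_divide norm_power power_mult_distrib power_divide)
  also have "\<dots> \<le> (norm c * norm z / 4) ^ n / fact n / Re \<kappa> ^ n"
    \<comment> \<open>The nested \<open>less_le_trans\<close> supplies positivity of the Pochhammer
      norm, needed for comparing the quotients.\<close>
    using assms by (intro divide_left_mono norm_pochhammer_ge mult_pos_pos
        less_le_trans[OF _ norm_pochhammer_ge]) auto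
  also have "\<dots> = (norm c * norm z / (4 * Re \<kappa>)) ^ n / fact n"
    by (simp add: power_mult_distrib power_divide)
  finally show ?thesis .
qed

lemma sums_exp_real: "(\<lambda>n. x ^ n / fact n) sums exp (x::real)"
  using exp_converges[of x] by (simp add: field_simps)

lemma summable_gen_bessel:
  assumes "Re \<kappa> > 0"
  shows "summable (\<lambda>n. (- c / 4) ^ n / pochhammer \<kappa> n * (z ^ n / fact n))"
  using norm_gen_bessel_term_le[OF assms]
  by (intro summable_comparison_test'[OF sums_summable[OF sums_exp_real]])

text \<open>Both the Bessel series and its majorant have constant term 1; dropping it from each
  leaves tails that compare termwise.\<close>

lemma norm_gen_bessel_minus_1_le:
  assumes "Re \<kappa> > 0"
  shows "norm (gen_bessel \<kappa> c z - 1) \<le> exp (norm c * norm z / (4 * Re \<kappa>)) - 1"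
proof -
  let ?f = "\<lambda>n. (- c / 4) ^ n / pochhammer \<kappa> n * (z ^ n / fact n)"
  let ?t = "norm c * norm z / (4 * Re \<kappa>)"
  have f: "?f sums gen_bessel \<kappa> c z"
    using summable_gen_bessel[OF assms] by (simp add: gen_bessel_def summable_sums)
  have "(\<lambda>n. ?f (Suc n)) sums (gen_bessel \<kappa> c z - ?f 0)"
    using f by (subst sums_Suc_iff) simp
  then have tail: "(\<lambda>n. ?f (Suc n)) sums (gen_bessel \<kappa> c z - 1)"
    by simp
  have "(\<lambda>n. ?t ^ Suc n / fact (Suc n)) sums (exp ?t - ?t ^ 0 / fact 0)"
    using sums_exp_real[of ?t] by (subst sums_Suc_iff) simp
  then have exp_tail: "(\<lambda>n. ?t ^ Suc n / fact (Suc n)) sums (exp ?t - 1)"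
    by simp
  have "norm (\<Sum>n. ?f (Suc n)) \<le> (\<Sum>n. ?t ^ Suc n / fact (Suc n))"
    using norm_gen_bessel_term_le[OF assms] sums_summable[OF exp_tail]
    by (intro norm_suminf_le)
  then show ?thesis
    using sums_unique[OF tail] sums_unique[OF exp_tail] by simp
qed

lemma gen_bessel_0 [simp]: "gen_bessel \<kappa> c 0 = 1"
  using powser_zero[of "\<lambda>n. (- c / 4) ^ n / pochhammer \<kappa> n / fact n"]
  by (simp add: gen_bessel_def)

lemma DERIV_gen_bessel:
  assumes "Re \<kappa> > 0"
  shows "(gen_bessel \<kappa> c has_field_derivative - (c / (4 * \<kappa>)) * gen_bessel (\<kappa> + 1) c z) (at z)"
proof -
  let ?a = "\<lambda>\<kappa> n. (- c / 4) ^ n / pochhammer \<kappa> n / fact n"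
  have eq: "gen_bessel \<kappa> c = (\<lambda>z. \<Sum>n. ?a \<kappa> n * z ^ n)" for \<kappa>
    by (simp add: gen_bessel_def fun_eq_iff)
  have summable: "summable (\<lambda>n. ?a \<kappa> n * z ^ n)" if "Re \<kappa> > 0" for \<kappa> z
    using summable_gen_bessel[OF that, of c z] by simp
  have "diffs (?a \<kappa>) n = - (c / (4 * \<kappa>)) * ?a (\<kappa> + 1) n" for n
    \<comment> \<open>\<open>pochhammer_rec\<close> splits off the first factor, \<open>pochhammer
      \<kappa> (Suc n) = \<kappa> * pochhammer (\<kappa> + 1) n\<close>, which raises the parameter.
      Keeping \<open>of_nat (Suc n)\<close> folded lets it cancel against
      \<open>fact (Suc n)\<close>.\<close>
    by (simp add: diffs_def pochhammer_rec del: of_nat_Suc)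
  then have "(\<Sum>n. diffs (?a \<kappa>) n * z ^ n) = (\<Sum>n. - (c / (4 * \<kappa>)) * (?a (\<kappa> + 1) n * z ^ n))"
    by (simp only: mult.assoc)
  also have "\<dots> = - (c / (4 * \<kappa>)) * gen_bessel (\<kappa> + 1) c z"
    unfolding eq using assms by (intro suminf_mult summable) simp
  finally show ?thesis
    using termdiffs_strong_converges_everywhere[OF summable[OF assms], of z]
    unfolding eq by simp
qed

lemma analytic_on_gen_bessel:
  assumes "Re \<kappa> > 0"
  shows "gen_bessel \<kappa> c analytic_on A"
proof -
  have "gen_bessel \<kappa> c holomorphic_on UNIV"
    using DERIV_gen_bessel[OF assms] by (auto simp: holomorphic_on_open)
  then show ?thesis
    by (metis analytic_on_open analytic_on_subset open_UNIV subset_UNIV)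
qed

lemma csqrt_1_plus_analytic: "(\<lambda>z. csqrt (1 + z)) analytic_on unit_disc"
proof (intro analytic_intros)
  fix z :: complex
  assume "z \<in> unit_disc"
  then have "Re (1 + z) > 0"
    using abs_Re_le_cmod[of z] by simp
  then show "1 + z \<notin> \<real>\<^sub>\<le>\<^sub>0"
    by (auto simp: complex_nonpos_Reals_iff)
qed

text \<open>A number with positive real part is the principal square root of its square, so no sign
  ambiguity arises; the value 1 at the origin makes the Schwarz function vanish there.\<close>

lemma subordinate_csqrtI:
  assumes "f analytic_on unit_disc" "f 0 = 1"
    and "\<And>z. z \<in> unit_disc \<Longrightarrow> Re (f z) > 0"
    and "\<And>z. z \<in> unit_disc \<Longrightarrow> norm ((f z)\<^sup>2 - 1) < 1"
  shows "f \<prec>\<^sub>s (\<lambda>z. csqrt (1 + z))"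
  unfolding subordinate_def
proof (intro conjI exI[of _ "\<lambda>z. (f z)\<^sup>2 - 1"] ballI)
  show "f z = csqrt (1 + ((f z)\<^sup>2 - 1))" if "z \<in> unit_disc" for z
    using assms(3)[OF that] by (simp add: csqrt_square)
qed (use assms csqrt_1_plus_analytic in \<open>auto intro!: analytic_intros\<close>)

theorem theorem2p1:
  fixes \<kappa> c :: complex
  assumes "c \<noteq> 0"
    and "Re \<kappa> > max 0 (norm c - 3/4)"
  shows "(\<lambda>z. - (4 * \<kappa> / c) * deriv (gen_bessel \<kappa> c) z) \<prec>\<^sub>s (\<lambda>z. csqrt (1 + z))"
proof -
  have pos: "Re \<kappa> > 0" and pos': "Re (\<kappa> + 1) > 0"
    using assms(2) by auto
  then have "\<kappa> \<noteq> 0"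
    by auto
  then have eq: "(\<lambda>z. - (4 * \<kappa> / c) * deriv (gen_bessel \<kappa> c) z) = gen_bessel (\<kappa> + 1) c"
    using assms(1) by (simp add: fun_eq_iff DERIV_imp_deriv[OF DERIV_gen_bessel[OF pos]])
  show ?thesis
    unfolding eq
  proof (intro subordinate_csqrtI analytic_on_gen_bessel pos' gen_bessel_0)
    fix z :: complex
    assume z: "z \<in> unit_disc"
    let ?u = "gen_bessel (\<kappa> + 1) c z"
    define t where "t = norm c * norm z / (4 * Re (\<kappa> + 1))"
    have "norm c * norm z \<le> norm c"
      using z by (simp add: mult_left_le)
    \<comment> \<open>The hypothesis gives \<open>norm c < Re \<kappa> + 3/4\<close>.\<close>
    also have "\<dots> < Re (\<kappa> + 1)"
      using assms(2) by simp
    finally have t: "0 \<le> t" "t < 1/4"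
      using pos' by (auto simp: t_def field_simps)
    have "(exp t)\<^sup>2 = exp (2 * t)"
      by (simp add: exp_double)
    also have "\<dots> < exp (1/2)"
      using t by simp
    \<comment> \<open>The threshold 1/4 for \<open>t\<close> leads to \<open>exp (1/2)\<close>,
      which is at most 2.\<close>
    finally have exp2: "(exp t)\<^sup>2 < 2"
      using exp_half_le2 by simp
    have "exp t \<le> (exp t)\<^sup>2"
      using t(1) by (simp add: self_le_power)
    with exp2 have exp1: "exp t < 2"
      by simp
    have bound: "norm (?u - 1) \<le> exp t - 1"
      unfolding t_def by (rule norm_gen_bessel_minus_1_le[OF pos'])
    \<comment> \<open>\<open>Re ?u\<close> is at least \<open>1 - norm (?u - 1)\<close>, hence at
      least \<open>2 - exp t\<close>.\<close>
    show "Re ?u > 0"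
      using abs_Re_le_cmod[of "?u - 1"] bound exp1 by simp
    \<comment> \<open>Writing \<open>?u + 1 = (?u - 1) + 2\<close> bounds the second factor of
      \<open>?u\<^sup>2 - 1\<close>; the product of the two bounds is again a difference of
      squares.\<close>
    have "norm (?u + 1) \<le> exp t + 1"
      using norm_triangle_ineq[of "?u - 1" 2] bound by (simp add: add.commute)
    then have "norm (?u - 1) * norm (?u + 1) \<le> (exp t - 1) * (exp t + 1)"
      using bound t(1) by (intro mult_mono) auto
    moreover have "?u\<^sup>2 - 1 = (?u - 1) * (?u + 1)"
      by (simp add: power2_eq_square algebra_simps)
    moreover have "(exp t - 1) * (exp t + 1) = (exp t)\<^sup>2 - 1"
      by (simp add: power2_eq_square algebra_simps)
    ultimately show "norm (?u\<^sup>2 - 1) < 1"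
      using exp2 by (simp add: norm_mult)
  qed
qed

end
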